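(* Let $\sigma\in\mathbb{R}^p$ be fixed. Assume that there exist an open neighborhood $\mathcal{I}\subset\mathbb{R}^p$ of $\sigma$ and continuous matrix-valued functions $\varsigma\in\mathcal{I}\mapsto K_\varsigma\in\mathbb{R}^{m\times n}$ and $\varsigma\in\mathcal{I}\mapsto L_\varsigma\in\mathbb{R}^{n\times\ell}$ such that $\varrho(\mathcal{A}_\sigma+\mathcal{B}_\sigma K_\sigma)<1$ and $\varrho(\mathcal{A}_\sigma+L_\sigma C)<1$. Then there exists a neighborhood $\mathcal{I}'\subset\mathcal{I}$ of $\sigma$ such that $\varrho(F(\sigma,\varsigma))<1$ for all $\varsigma\in\mathcal{I}'$.
   Context: Fix positive integers $n,m,\ell,p$, matrices $B\in\mathbb{R}^{n\times m}$ and $C\in\mathbb{R}^{\ell\times n}$, a time step $\Delta t>0$, and a family of matrices $A_\varsigma\in\mathbb{R}^{n\times n}$ depending continuously on $\varsigma\in\mathbb{R}^p$. Define $$\mathcal{A}_\varsigma = e^{A_\varsigma\Delta t},\qquad \mathcal{B}_\varsigma=\int_0^{\Delta t}e^{A_\varsigma(\Delta t-\tau)}\,\mathrm{d}\tau\,B,$$ which depend continuously on $\varsigma$. $\varrho(M)$ denotes the spectral radius of a square matrix $M$. For $\varsigma\in\mathcal{I}$ the matrix $F(\sigma,\varsigma)\in\mathbb{R}^{2n\times 2n}$ is $$F(\sigma,\varsigma)=\begin{bmatrix}\mathcal{A}_\sigma+\mathcal{B}_\sigma K_\varsigma & -\mathcal{B}_\sigma K_\varsigma\\ \mathcal{A}_\sigma-\mathcal{A}_\varsigma+(\mathcal{B}_\sigma-\mathcal{B}_\varsigma)K_\varsigma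 & \mathcal{A}_\varsigma+L_\varsigma C-(\mathcal{B}_\sigma-\mathcal{B}_\varsigma)K_\varsigma\end{bmatrix}.$$ *)

theory Defs
  imports "HOL-Analysis.Analysis"
begin

text \<open>The operations \<open>*\<close>, \<open>^\<close> on \<^typ>\<open>real^'n^'n\<close> are componentwise, so powers
  with respect to the matrix product \<open>**\<close> are written as iterates.\<close>

definition mat_exp :: "real^'n^'n \<Rightarrow> real^'n^'n"
  where "mat_exp A = (\<Sum>k. (1 / fact k) *\<^sub>R (((**) A ^^ k) (mat 1)))"

definition mat_eigenvalues :: "complex^'n^'n \<Rightarrow> complex set"
  where "mat_eigenvalues M = {z. \<exists>v. v \<noteq> 0 \<and> M *v v = z *s v}"

text \<open>The spectrum of a real matrix is taken over the complex numbers; there it is finite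
  and nonempty, so that the maximum is meaningful.\<close>

definition mat_spectral_radius :: "real^'n^'n \<Rightarrow> real"
  where "mat_spectral_radius M = Max (cmod ` mat_eigenvalues (map_matrix complex_of_real M))"

text \<open>The block matrix with rows \<open>[P, Q]\<close> and \<open>[R, S]\<close>; the sum type indexes the first block
  by \<open>Inl\<close> and the second one by \<open>Inr\<close>.\<close>

definition mat_block ::
    "'a^'c^'r \<Rightarrow> 'a^'d^'r \<Rightarrow> 'a^'c^'s \<Rightarrow> 'a^'d^'s \<Rightarrow> 'a^('c + 'd)^('r + 's)"
  where "mat_block P Q R S =
    (\<chi> i j. case i of
        Inl i' \<Rightarrow> (case j of Inl j' \<Rightarrow> P $ i' $ j' | Inr j' \<Rightarrow> Q $ i' $ j')
      | Inr i' \<Rightarrow> (case j of Inl j' \<Rightarrow> R $ i' $ j' | Inr j' \<Rightarrow> S $ i' $ j'))"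

text \<open>Exact (zero-order hold) discretization of \<open>x' = A x + B u\<close> with time step \<open>dt\<close>.\<close>

definition disc_A :: "real \<Rightarrow> real^'n^'n \<Rightarrow> real^'n^'n"
  where "disc_A dt A = mat_exp (dt *\<^sub>R A)"

definition disc_B :: "real \<Rightarrow> real^'n^'n \<Rightarrow> real^'m^'n \<Rightarrow> real^'m^'n"
  where "disc_B dt A B = integral {0..dt} (\<lambda>\<tau>. mat_exp ((dt - \<tau>) *\<^sub>R A)) ** B"

text \<open>Here \<open>s\<close> is the true parameter and \<open>t\<close> the one used for the feedback gain \<open>K t\<close>
  and the observer gain \<open>L t\<close>.\<close>

definition closed_loop ::
    "real \<Rightarrow> ('p \<Rightarrow> real^'n^'n) \<Rightarrow> real^'m^'n \<Rightarrow> real^'n^'l \<Rightarrow>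
     ('p \<Rightarrow> real^'n^'m) \<Rightarrow> ('p \<Rightarrow> real^'l^'n) \<Rightarrow> 'p \<Rightarrow> 'p \<Rightarrow> real^('n + 'n)^('n + 'n)"
  where "closed_loop dt A B C K L s t =
    (let As = disc_A dt (A s); At = disc_A dt (A t);
         Bs = disc_B dt (A s) B; Bt = disc_B dt (A t) B
     in mat_block
          (As + Bs ** K t)                    (- (Bs ** K t))
          (As - At + (Bs - Bt) ** K t)        (At + L t ** C - (Bs - Bt) ** K t))"

end

theory Submission
  imports Defs "HOL-Computational_Algebra.Fundamental_Theorem_Algebra"
begin

text \<open>
  All eigenvalues of \<open>M\<close> lie in the open unit disc iff \<open>det (1 - w M)\<close> has no zero \<open>w\<close> in the
  closed unit disc. As this disc is compact and the determinant is jointly continuous, the tube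
  lemma shows that the condition persists under small perturbations of \<open>M\<close>. At \<open>t = \<sigma>\<close> the
  closed-loop matrix is block upper triangular, and its eigenvalues are among those of the two
  diagonal blocks.
\<close>

section \<open>Eigenvalues and the spectral radius\<close>

lemma mat_component: "mat w $ i $ j = (if i = j then w else 0)"
  by (simp add: mat_def)

lemma mat_vector_mult: "mat w *v x = w *s (x :: 'a::semiring_1^'n)"
  by (simp add: vec_eq_iff matrix_vector_mult_def mat_def if_distrib[of "\<lambda>u. u * _"] cong: if_cong)

text \<open>The product \<open>mat w ** M\<close> serves as the complex multiple of \<open>M\<close>
  by \<open>w\<close>, so that \<open>det_mul\<close> applies to it directly.\<close>

lemma mat_matrix_mult: "(mat w ** M) $ i $ j = w * (M :: 'a::semiring_1^'n^'m) $ i $ j"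
  by (simp add: matrix_matrix_mult_def mat_def if_distrib[of "\<lambda>u. u * _"] cong: if_cong)

lemma det_mat: "det (mat w :: 'a::comm_ring_1^'n^'n) = w ^ CARD('n)"
  by (subst det_diagonal) (auto simp: mat_def)

lemma det_eq_0_iff_kernel:
  fixes M :: "'a::field^'n^'n"
  shows "det M = 0 \<longleftrightarrow> (\<exists>v. v \<noteq> 0 \<and> M *v v = 0)"
  using invertible_det_nz[of M] invertible_left_inverse[of M] matrix_left_invertible_ker[of M]
  by blast

lemma mat_eigenvalues_iff_det: "z \<in> mat_eigenvalues M \<longleftrightarrow> det (mat z - M) = 0"
  by (auto simp: mat_eigenvalues_def det_eq_0_iff_kernel matrix_vector_mult_diff_rdistrib
      mat_vector_mult)

text \<open>Factor out \<open>w\<close>. Nonzero zeros of \<open>det (mat 1 - mat w ** M)\<close>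
  are thus the reciprocals of nonzero eigenvalues, which turns the unbounded region outside the open
  unit disc into part of a compact disc.\<close>

lemma det_reciprocal:
  fixes M :: "complex^'n^'n"
  assumes "w \<noteq> 0"
  shows "det (mat 1 - mat w ** M) = w ^ CARD('n) * det (mat (1 / w) - M)"
proof -
  have "mat 1 - mat w ** M = mat w ** (mat (1 / w) - M)"
    using assms by (simp add: vec_eq_iff mat_matrix_mult mat_component field_simps)
  then show ?thesis
    by (simp add: det_mul det_mat)
qed

lemma continuous_on_det [continuous_intros]:
  fixes f :: "'a::topological_space \<Rightarrow> 'b::real_normed_field^'n^'n"
  assumes "continuous_on S f"
  shows "continuous_on S (\<lambda>x. det (f x))"
  unfolding det_def by (intro continuous_intros assms)

lemma continuous_on_matrix_mult [continuous_intros]: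
  fixes f :: "'a::topological_space \<Rightarrow> 'b::real_normed_field^'n^'m"
    and g :: "'a \<Rightarrow> 'b^'p^'n"
  assumes "continuous_on S f" "continuous_on S g"
  shows "continuous_on S (\<lambda>x. f x ** g x)"
  unfolding matrix_matrix_mult_def by (intro continuous_intros assms)

lemma continuous_on_mat [continuous_intros]:
  fixes f :: "'a::topological_space \<Rightarrow> 'b::real_normed_field"
  assumes "continuous_on S f"
  shows "continuous_on S (\<lambda>x. mat (f x) :: 'b^'n^'n)"
proof -
  have "continuous_on S (\<lambda>x. if i = j then f x else 0)" for i j :: 'n
    using assms by (cases "i = j") auto
  then show ?thesis
    unfolding mat_def by (intro continuous_intros)
qed

text \<open>The determinant is taken over the polynomial ring; evaluation at \<open>z\<close>
  commutes with the sums and products of the Leibniz formula.\<close>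

lemma char_poly_exists:
  fixes M :: "'a::comm_ring_1^'n^'n"
  shows "\<exists>p. \<forall>z. poly p z = det (mat z - M)"
proof
  let ?P = "(\<chi> i j. if i = j then [:- M $ i $ j, 1:] else [:- M $ i $ j:]) :: 'a poly^'n^'n"
  have "poly (?P $ i $ j) z = (mat z - M) $ i $ j" for i j z
    by (simp add: mat_component)
  then show "\<forall>z. poly (det ?P) z = det (mat z - M)"
    unfolding det_def by (simp add: poly_sum poly_prod of_int_poly)
qed

text \<open>If \<open>det (z - M)\<close> were a constant \<open>c\<close>, then \<open>det (1 - w M) = c w^n\<close> for \<open>w \<noteq> 0\<close>; but
  the left-hand side tends to 1 as \<open>w\<close> tends to 0.\<close>

lemma char_poly_nonconstant:
  fixes M :: "complex^'n^'n"
  assumes p: "\<And>z. poly p z = det (mat z - M)"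
  shows "\<not> constant (poly p)"
proof
  assume "constant (poly p)"
  then have c: "poly p z = poly p 0" for z
    unfolding constant_def by blast
  have "continuous_on UNIV (\<lambda>w. det (mat 1 - mat w ** M))"
    by (intro continuous_intros)
  then have "((\<lambda>w. det (mat 1 - mat w ** M)) \<longlongrightarrow> det (mat 1 - mat 0 ** M)) (at 0)"
    unfolding continuous_on_def by blast
  moreover have "det (mat 1 - mat 0 ** M) = 1"
    by simp
  \<comment> \<open>The filter \<open>at 0\<close> leaves out the point 0 itself, where
    \<open>det_reciprocal\<close> does not apply.\<close>
  moreover have "\<forall>\<^sub>F w in at 0. det (mat 1 - mat w ** M) = w ^ CARD('n) * poly p 0"
    using c by (auto simp: eventually_at_filter det_reciprocal simp flip: p)
  ultimately have "((\<lambda>w. w ^ CARD('n) * poly p 0) \<longlongrightarrow> 1) (at (0::complex))"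
    by (auto intro: Lim_transform_eventually)
  moreover have "((\<lambda>w. w ^ CARD('n) * poly p 0) \<longlongrightarrow> 0 ^ CARD('n) * poly p 0) (at (0::complex))"
    by (intro tendsto_intros)
  ultimately have "1 = 0 ^ CARD('n) * poly p 0"
    using tendsto_unique trivial_limit_at by blast
  \<comment> \<open>The exponent \<open>CARD('n)\<close> is positive, so the right-hand side is
    0.\<close>
  then show False
    by (simp add: power_0_left)
qed

text \<open>The eigenvalues are the roots of a nonconstant polynomial: finitely many, and at least
  one by the fundamental theorem of algebra. Both facts are required to reason about
  \<open>Max\<close> in \<open>mat_spectral_radius\<close>.\<close>

lemma finite_mat_eigenvalues: "finite (mat_eigenvalues M)"
  and mat_eigenvalues_nonempty: "mat_eigenvalues M \<noteq> {}"
proof -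
  obtain p where p: "\<And>z. poly p z = det (mat z - M)"
    using char_poly_exists by metis
  have nc: "\<not> constant (poly p)"
    using p by (rule char_poly_nonconstant)
  have eq: "mat_eigenvalues M = {z. poly p z = 0}"
    by (auto simp: mat_eigenvalues_iff_det p)
  have "p \<noteq> 0"
    using nc by (auto simp: constant_def)
  then show "finite (mat_eigenvalues M)"
    unfolding eq by (rule poly_roots_finite)
  show "mat_eigenvalues M \<noteq> {}"
    using fundamental_theorem_of_algebra[OF nc] eq by auto
qed

lemma mat_spectral_radius_less_iff:
  "mat_spectral_radius M < r \<longleftrightarrow>
    (\<forall>z\<in>mat_eigenvalues (map_matrix complex_of_real M). cmod z < r)"
  unfolding mat_spectral_radius_def
  by (subst Max_less_iff) (auto simp: finite_mat_eigenvalues mat_eigenvalues_nonempty)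

text \<open>At \<open>w = 0\<close> the determinant is 1; any other zero \<open>w\<close> in the
  closed disc corresponds to an eigenvalue \<open>1 / w\<close> of modulus at least 1.\<close>

lemma mat_spectral_radius_less_1_iff_det:
  "mat_spectral_radius M < 1 \<longleftrightarrow>
    (\<forall>w\<in>cball 0 1. det (mat 1 - mat w ** map_matrix complex_of_real M) \<noteq> 0)"
  (is "_ \<longleftrightarrow> (\<forall>w\<in>_. ?d w \<noteq> 0)")
proof
  assume rad: "mat_spectral_radius M < 1"
  show "\<forall>w\<in>cball 0 1. ?d w \<noteq> 0"
  proof
    fix w :: complex assume w: "w \<in> cball 0 1"
    show "?d w \<noteq> 0"
    proof (cases "w = 0")
      case False
      have "\<not> cmod (1 / w) < 1"
        using w False by (simp add: norm_divide)
      then have "1 / w \<notin> mat_eigenvalues (map_matrix complex_of_real M)"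
        using rad mat_spectral_radius_less_iff by blast
      then show ?thesis
        using False by (simp add: det_reciprocal mat_eigenvalues_iff_det)
    qed simp
  qed
next
  assume nz: "\<forall>w\<in>cball 0 1. ?d w \<noteq> 0"
  have "cmod z < 1" if z: "z \<in> mat_eigenvalues (map_matrix complex_of_real M)" for z
  proof (rule ccontr)
    assume "\<not> cmod z < 1"
    then have "z \<noteq> 0" "1 / z \<in> cball 0 1"
      by (auto simp: norm_divide divide_simps)
    moreover from this have "?d (1 / z) = 0"
      using z by (simp add: det_reciprocal mat_eigenvalues_iff_det)
    ultimately show False
      using nz by blast
  qed
  then show "mat_spectral_radius M < 1"
    by (simp add: mat_spectral_radius_less_iff)
qed

lemma mat_spectral_radius_less_1_neighbourhood:
  fixes F :: "'a::topological_space \<Rightarrow> real^'n^'n"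
  assumes "open S" "x \<in> S" and F: "continuous_on S F" and "mat_spectral_radius (F x) < 1"
  shows "\<exists>U. open U \<and> x \<in> U \<and> U \<subseteq> S \<and> (\<forall>y\<in>U. mat_spectral_radius (F y) < 1)"
proof -
  let ?d = "\<lambda>q. det (mat 1 - mat (snd q) ** map_matrix complex_of_real (F (fst q)))"
  \<comment> \<open>\<open>?W\<close> collects the pairs (y, w) with nonvanishing determinant. It is
    open and contains the compact slice over \<open>x\<close>, hence a whole tube around it.\<close>
  let ?W = "(S \<times> UNIV) \<inter> ?d -` (- {0})"
  have "continuous_on (S \<times> UNIV) (\<lambda>q. F (fst q) :: real^'n^'n)"
    by (rule continuous_on_compose2[OF F]) (auto intro: continuous_intros)
  then have "continuous_on (S \<times> (UNIV :: complex set)) ?d"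
    unfolding map_matrix_def by (intro continuous_intros)
  then have W: "open ?W"
    using \<open>open S\<close> by (intro continuous_open_preimage) (auto intro: open_Times)
  have sub: "{x} \<times> cball 0 1 \<subseteq> ?W"
    using assms by (auto simp: mat_spectral_radius_less_1_iff_det)
  obtain U where U: "x \<in> U" "open U" "U \<times> cball 0 1 \<subseteq> ?W"
    using Elementary_Topology.tube_lemma[OF compact_cball W sub] by (elim exE conjE)
  have "y \<in> S" if "y \<in> U" for y
  proof -
    \<comment> \<open>The point 0 is just a sample from the disc, used to read off the first
      coordinate.\<close>
    have "(y, 0) \<in> U \<times> cball 0 1"
      using that by simp
    with U(3) have "(y, 0) \<in> ?W"
      by (rule subsetD)
    then show ?thesis
      by simp
  qed
  moreover have "mat_spectral_radius (F y) < 1" if "y \<in> U" for y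
    unfolding mat_spectral_radius_less_1_iff_det
  proof
    fix w :: complex assume "w \<in> cball 0 1"
    then have "(y, w) \<in> U \<times> cball 0 1"
      using that by simp
    with U(3) have "(y, w) \<in> ?W"
      by (rule subsetD)
    then show "det (mat 1 - mat w ** map_matrix complex_of_real (F y)) \<noteq> 0"
      by simp
  qed
  ultimately show ?thesis
    using U(1,2) by blast
qed

section \<open>Block matrices\<close>

lemma sum_UNIV_Plus:
  fixes f :: "'a::finite + 'b::finite \<Rightarrow> 'c::comm_monoid_add"
  shows "sum f UNIV = (\<Sum>i\<in>UNIV. f (Inl i)) + (\<Sum>i\<in>UNIV. f (Inr i))"
  using sum.Plus[of UNIV UNIV f] by (simp add: UNIV_Plus_UNIV o_def)

lemma mat_block_vector_mult:
  "(mat_block P Q R S *v v) $ Inl i = (P *v (\<chi> j. v $ Inl j)) $ i + (Q *v (\<chi> j. v $ Inr j)) $ i"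
  "(mat_block P Q R S *v v) $ Inr k = (R *v (\<chi> j. v $ Inl j)) $ k + (S *v (\<chi> j. v $ Inr j)) $ k"
  by (simp_all add: matrix_vector_mult_def mat_block_def sum_UNIV_Plus)

lemma map_matrix_mat_block:
  "map_matrix f (mat_block P Q R S) =
    mat_block (map_matrix f P) (map_matrix f Q) (map_matrix f R) (map_matrix f S)"
  by (simp add: vec_eq_iff mat_block_def split: sum.split)

lemma continuous_on_mat_block [continuous_intros]:
  assumes "continuous_on T P" "continuous_on T Q" "continuous_on T R" "continuous_on T S"
  shows "continuous_on T (\<lambda>x. mat_block (P x) (Q x) (R x) (S x))"
proof -
  have "continuous_on T (\<lambda>x. mat_block (P x) (Q x) (R x) (S x) $ i $ j)" for i j
    unfolding mat_block_def using assms
    by (cases i; cases j) (auto intro!: continuous_intros)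
  then have "continuous_on T (\<lambda>x. \<chi> i j. mat_block (P x) (Q x) (R x) (S x) $ i $ j)"
    by (intro continuous_on_vec_lambda)
  then show ?thesis
    by simp
qed

text \<open>Split an eigenvector into (x, y). The lower block row makes \<open>y\<close> an
  eigenvector of \<open>S\<close> unless \<open>y = 0\<close>; in that case the upper row makes
  \<open>x\<close> an eigenvector of \<open>P\<close>.\<close>

lemma mat_eigenvalues_block_triangular:
  fixes P :: "complex^'n^'n" and S :: "complex^'m^'m"
  shows "mat_eigenvalues (mat_block P Q 0 S) \<subseteq> mat_eigenvalues P \<union> mat_eigenvalues S"
proof
  fix z assume "z \<in> mat_eigenvalues (mat_block P Q 0 S)"
  then obtain v where "v \<noteq> 0" and ev: "mat_block P Q 0 S *v v = z *s v"
    by (auto simp: mat_eigenvalues_def)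
  define x where "x = (\<chi> j. v $ Inl j)"
  define y where "y = (\<chi> j. v $ Inr j)"
  have upper: "P *v x + Q *v y = z *s x"
    using ev mat_block_vector_mult(1)[of P Q 0 S v] by (simp add: vec_eq_iff x_def y_def)
  have lower: "S *v y = z *s y"
    using ev mat_block_vector_mult(2)[of P Q 0 S v] by (simp add: vec_eq_iff x_def y_def)
  show "z \<in> mat_eigenvalues P \<union> mat_eigenvalues S"
  proof (cases "y = 0")
    case True
    have "x \<noteq> 0"
    proof
      assume "x = 0"
      with True have "v $ k = 0" for k
        by (cases k) (auto simp: x_def y_def vec_eq_iff)
      with \<open>v \<noteq> 0\<close> show False
        by (simp add: vec_eq_iff)
    qed
    with upper True show ?thesis
      by (auto simp: mat_eigenvalues_def)
  next
    case False
    with lower show ?thesis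
      by (auto simp: mat_eigenvalues_def)
  qed
qed

lemma mat_spectral_radius_block_triangular_less:
  assumes "mat_spectral_radius P < r" "mat_spectral_radius S < r"
  shows "mat_spectral_radius (mat_block P Q 0 S) < r"
proof -
  \<comment> \<open>Keeps the lower left block literally zero after passing to complex
    entries.\<close>
  have zero: "map_matrix complex_of_real 0 = 0"
    by (simp add: vec_eq_iff)
  show ?thesis
    using assms mat_eigenvalues_block_triangular
    unfolding mat_spectral_radius_less_iff map_matrix_mat_block zero by blast
qed

section \<open>Continuity of the discretization\<close>

lemma bounded_bilinear_matrix_mult:
  "bounded_bilinear ((**) :: real^'n^'m \<Rightarrow> real^'p^'n \<Rightarrow> real^'p^'m)"
proof -
  have "bilinear ((**) :: real^'n^'m \<Rightarrow> real^'p^'n \<Rightarrow> real^'p^'m)"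
    unfolding bilinear_def
    by (auto intro!: linearI simp: vec_eq_iff matrix_matrix_mult_def algebra_simps sum.distrib
        sum_distrib_left)
  then show ?thesis
    by (simp add: bilinear_conv_bounded_bilinear)
qed

lemma continuous_on_matrix_power [continuous_intros]:
  fixes f :: "'a::topological_space \<Rightarrow> real^'n^'n"
  assumes "continuous_on S f"
  shows "continuous_on S (\<lambda>x. ((**) (f x) ^^ k) (mat 1))"
  by (induction k) (auto intro!: continuous_intros assms)

text \<open>The norm is only assumed submultiplicative up to a factor \<open>b\<close>, as
  boundedness of the bilinear product provides; each multiplication then costs at most
  \<open>r * b\<close>.\<close>

lemma norm_matrix_power_le:
  fixes A :: "real^'n^'n"
  assumes "\<And>(A :: real^'n^'n) (B :: real^'n^'n). norm (A ** B) \<le> norm A * norm B * b"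
    "b \<ge> 0" "norm A \<le> r"
  shows "norm (((**) A ^^ k) (mat 1)) \<le> (r * b) ^ k * norm (mat 1 :: real^'n^'n)"
proof (induction k)
  case (Suc k)
  have "norm (((**) A ^^ Suc k) (mat 1)) \<le> norm A * norm (((**) A ^^ k) (mat 1)) * b"
    using assms(1)[of A "((**) A ^^ k) (mat 1)"] by simp
  also have "\<dots> \<le> r * ((r * b) ^ k * norm (mat 1 :: real^'n^'n)) * b"
    using assms(2,3) Suc order_trans[OF norm_ge_zero assms(3)]
    by (intro mult_mono mult_nonneg_nonneg) auto
  finally show ?case
    by (simp add: algebra_simps)
qed simp

text \<open>On each ball the series is dominated by a scalar exponential series, so the Weierstrass
  M-test makes the limit continuous there; continuity being local, balls suffice.\<close>

lemma continuous_on_mat_exp: "continuous_on UNIV (mat_exp :: real^'n^'n \<Rightarrow> real^'n^'n)"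
proof -
  obtain b where b: "b \<ge> 0" "\<And>(A :: real^'n^'n) (B :: real^'n^'n). norm (A ** B) \<le> norm A * norm B * b"
    using bounded_bilinear.nonneg_bounded[OF bounded_bilinear_matrix_mult] by blast
  have cball: "continuous_on (cball 0 r) (mat_exp :: real^'n^'n \<Rightarrow> real^'n^'n)" for r
  proof -
    let ?f = "\<lambda>k (A :: real^'n^'n). (1 / fact k) *\<^sub>R (((**) A ^^ k) (mat 1))"
    let ?M = "\<lambda>k. (r * b) ^ k /\<^sub>R fact k * norm (mat 1 :: real^'n^'n)"
    have "summable ?M"
      by (intro summable_mult2 summable_exp_generic)
    moreover have "norm (?f k A) \<le> ?M k" if "A \<in> cball 0 r" for k A
      using norm_matrix_power_le[OF b(2,1), of A r k] that by (simp add: field_simps)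
    ultimately have "uniform_limit (cball 0 r) (\<lambda>n A. \<Sum>k<n. ?f k A) (\<lambda>A. \<Sum>k. ?f k A) sequentially"
      by (intro Weierstrass_m_test)
    then show ?thesis
      unfolding mat_exp_def
      by (rule uniform_limit_theorem[rotated])
        (auto intro!: always_eventually continuous_intros)
  qed
  have "isCont mat_exp A" for A :: "real^'n^'n"
  proof (rule continuous_on_interior[OF cball])
    show "A \<in> interior (cball 0 (norm A + 1))"
      by simp
  qed
  then show ?thesis
    by (simp add: continuous_at_imp_continuous_on)
qed

lemma continuous_on_disc_A: "continuous_on UNIV (disc_A dt)"
  unfolding disc_A_def
  by (rule continuous_on_compose2[OF continuous_on_mat_exp]) (auto intro: continuous_intros)

text \<open>The integrand is jointly continuous in the matrix and in time, and the time interval is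
  compact.\<close>

lemma continuous_on_disc_B:
  fixes B :: "real^'m^'n"
  shows "continuous_on UNIV (\<lambda>A. disc_B dt A B)"
proof -
  let ?f = "\<lambda>(A :: real^'n^'n) \<tau>. mat_exp ((dt - \<tau>) *\<^sub>R A)"
  have "continuous_on (UNIV \<times> cbox 0 dt) (\<lambda>(A, \<tau>). ?f A \<tau>)"
    unfolding case_prod_beta
    by (rule continuous_on_compose2[OF continuous_on_mat_exp]) (auto intro!: continuous_intros)
  then have "continuous_on UNIV (\<lambda>A. integral (cbox 0 dt) (?f A))"
    by (rule integral_continuous_on_param)
  then show ?thesis
    unfolding disc_B_def by (intro continuous_on_matrix_mult continuous_on_const) simp
qed

lemma continuous_on_closed_loop:
  fixes A :: "'p::topological_space \<Rightarrow> real^'n^'n"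
  assumes A: "continuous_on S A" and K: "continuous_on S K" and L: "continuous_on S L"
  shows "continuous_on S (closed_loop dt A B C K L s)"
proof -
  have "continuous_on S (\<lambda>t. disc_A dt (A t))"
    by (rule continuous_on_compose2[OF continuous_on_disc_A A]) simp
  moreover have "continuous_on S (\<lambda>t. disc_B dt (A t) B)"
    by (rule continuous_on_compose2[OF continuous_on_disc_B A]) simp
  ultimately show ?thesis
    unfolding closed_loop_def Let_def by (intro continuous_intros K L)
qed

theorem theorem3p1:
  fixes B :: "real^'m^'n" and C :: "real^'n^'l" and dt :: real
    and A :: "real^'p \<Rightarrow> real^'n^'n"
    and \<sigma> :: "real^'p" and I :: "(real^'p) set"
    and K :: "real^'p \<Rightarrow> real^'n^'m" and L :: "real^'p \<Rightarrow> real^'l^'n"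
  assumes "dt > 0"
    and "continuous_on UNIV A"
    and "open I" and "\<sigma> \<in> I"
    and "continuous_on I K" and "continuous_on I L"
    and "mat_spectral_radius (disc_A dt (A \<sigma>) + disc_B dt (A \<sigma>) B ** K \<sigma>) < 1"
    and "mat_spectral_radius (disc_A dt (A \<sigma>) + L \<sigma> ** C) < 1"
  shows "\<exists>I'. open I' \<and> \<sigma> \<in> I' \<and> I' \<subseteq> I \<and>
           (\<forall>t\<in>I'. mat_spectral_radius (closed_loop dt A B C K L \<sigma> t) < 1)"
proof (rule mat_spectral_radius_less_1_neighbourhood)
  show "continuous_on I (closed_loop dt A B C K L \<sigma>)"
    using assms by (intro continuous_on_closed_loop) (auto intro: continuous_on_subset)
  \<comment> \<open>With equal parameters all differences cancel. This is the separation principle: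
    state feedback and observer error decouple into the two diagonal blocks.\<close>
  have "closed_loop dt A B C K L \<sigma> \<sigma> =
      mat_block (disc_A dt (A \<sigma>) + disc_B dt (A \<sigma>) B ** K \<sigma>) (- (disc_B dt (A \<sigma>) B ** K \<sigma>))
        0 (disc_A dt (A \<sigma>) + L \<sigma> ** C)"
    by (simp add: closed_loop_def Let_def)
  then show "mat_spectral_radius (closed_loop dt A B C K L \<sigma> \<sigma>) < 1"
    using assms by (simp add: mat_spectral_radius_block_triangular_less)
qed (use assms in auto)

end
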